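(* The map defined by $$\mathcal{R}(M,MJS)=-M(S+2J)^{-1}(S-2J),$$ where $M\in Sp(2n,\mathbb{R})$, $S\in Sym(2n,\mathbb{R})$ and $\det(S+2J)\neq 0$, is a retraction for the real symplectic group $Sp(2n,\mathbb{R})$.
   Context: $J=\begin{bmatrix}0&\mathbb{I}_n\\-\mathbb{I}_n&0\end{bmatrix}$, $Sp(2n,\mathbb{R})=\{M\in\mathcal{M}_{2n}(\mathbb{R}) : M^TJM=J\}$, and $Sym(2n,\mathbb{R})$ is the space of real symmetric $2n\times 2n$ matrices. For $M\in Sp(2n,\mathbb{R})$ the tangent space is $T_MSp(2n,\mathbb{R})=\{MJS : S\in Sym(2n,\mathbb{R})\}$, and $S$ is uniquely determined by the tangent vector $MJS$. A retraction on a manifold $\mathcal{S}$ is a smooth mapping $\mathcal{R}:T\mathcal{S}\to\mathcal{S}$ such that, writing $\mathcal{R}_x$ for the restriction of $\mathcal{R}$ to $T_x\mathcal{S}$: (i) $\mathcal{R}_x(0_x)=x$ for all $x\in\mathcal{S}$, where $0_x$ is the zero of $T_x\mathcal{S}$; (ii) with the canonical identification $T_{0_x}T_x\mathcal{S}\simeq T_x\mathcal{S}$, $D_{0_x}\mathcal{R}_x(v_x)=v_x$ for all $v_x\in T_x\mathcal{S}$. Here the map $\mathcal{R}$ is defined on the open subset $\{(M,MJS): M\in Sp(2n,\mathbb{R}),\ S\in Sym(2n,\mathbb{R}),\ \det(S+2J)\ne 0\}$ of $TSp(2n,\mathbb{R})$, which contains the zero section, and being a retraction means that $\mathcal{R}$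 is smooth on this subset, takes values in $Sp(2n,\mathbb{R})$, and satisfies (i) and (ii). *)

theory Defs
  imports "HOL-Analysis.Analysis"
begin

text \<open>
  Real \<open>2n \<times> 2n\<close> matrices are indexed by the sum type \<open>'n + 'n\<close> with \<open>n = CARD('n)\<close>: the indices
  \<open>Inl a\<close> and \<open>Inr a\<close> are those of the first and of the second block.
\<close>

type_synonym 'n mat2 = "real ^ ('n + 'n) ^ ('n + 'n)"

definition symp_J :: "'n::finite mat2" where
  "symp_J = (\<chi> i j. case (i, j) of
       (Inl a, Inr b) \<Rightarrow> if a = b then 1 else 0
     | (Inr a, Inl b) \<Rightarrow> if a = b then - 1 else 0
     | _ \<Rightarrow> 0)"

definition Sp :: "'n::finite mat2 set" where
  "Sp = {M. transpose M ** symp_J ** M = symp_J}"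

definition Sym :: "'n::finite mat2 set" where
  "Sym = {S. transpose S = S}"

definition Sp_tangent :: "'n::finite mat2 \<Rightarrow> 'n mat2 set" where
  "Sp_tangent M = {M ** symp_J ** S | S. S \<in> Sym}"


subsection \<open>Smooth maps\<close>

fun Ck_on :: "nat \<Rightarrow> 'a::euclidean_space set \<Rightarrow> ('a \<Rightarrow> 'b::euclidean_space) \<Rightarrow> bool" where
  "Ck_on 0 U f \<longleftrightarrow> continuous_on U f"
| "Ck_on (Suc k) U f \<longleftrightarrow> (\<forall>x\<in>U. f differentiable (at x)) \<and>
     (\<forall>v. Ck_on k U (\<lambda>x. frechet_derivative f (at x) v))"

text \<open>
  Smoothness on an arbitrary subset of a Euclidean space means local extendability to a
  \<open>C\<^sup>\<infinity>\<close> map on an open set of the ambient space. If \<open>X\<close> is (an open subset of) an embedded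
  submanifold, and if the values lie in an embedded submanifold, this is smoothness in the sense
  of manifolds. \<open>Ck_on\<close> itself is only meaningful on open sets.
\<close>

definition smooth_map_on :: "'a::euclidean_space set \<Rightarrow> ('a \<Rightarrow> 'b::euclidean_space) \<Rightarrow> bool" where
  "smooth_map_on X f \<longleftrightarrow>
     (\<forall>x\<in>X. \<exists>U g. open U \<and> x \<in> U \<and> (\<forall>k. Ck_on k U g) \<and> (\<forall>y\<in>X \<inter> U. g y = f y))"


subsection \<open>Retractions on manifolds\<close>

text \<open>
  \<open>X\<close> is an embedded submanifold of a Euclidean space with tangent spaces \<open>T x\<close>, so that its tangent
  bundle is the set \<open>Sigma X T\<close> of pairs. The retraction \<open>R\<close> is defined on a subset \<open>D\<close> of the tangent
  bundle, open in it and containing the zero section; its values outside \<open>D\<close> are irrelevant.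
  In the last clause the derivative at \<open>0\<close> is taken within the domain of \<open>R\<^sub>x\<close>, a neighbourhood of
  \<open>0\<close> in \<open>T x\<close>. This determines \<open>L\<close> on \<open>T x\<close>, where it is the differential of \<open>R\<^sub>x\<close> at \<open>0\<close>, but not
  on the rest of the ambient space.
  (This is unrelated to the topological notion \<^const>\<open>retraction\<close>.)
\<close>

definition manifold_retraction ::
  "'a::euclidean_space set \<Rightarrow> ('a \<Rightarrow> 'a set) \<Rightarrow> ('a \<times> 'a) set \<Rightarrow> ('a \<times> 'a \<Rightarrow> 'a) \<Rightarrow> bool" where
  "manifold_retraction X T D R \<longleftrightarrow>
     openin (top_of_set (Sigma X T)) D \<and>
     (\<forall>x\<in>X. (x, 0) \<in> D) \<and>
     R ` D \<subseteq> X \<and>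
     smooth_map_on D R \<and>
     (\<forall>x\<in>X. R (x, 0) = x) \<and>
     (\<forall>x\<in>X. \<exists>L. ((\<lambda>v. R (x, v)) has_derivative L) (at 0 within {v. (x, v) \<in> D}) \<and>
               (\<forall>v\<in>T x. L v = v))"


subsection \<open>The map on the tangent bundle of the symplectic group\<close>

definition Sp_retr_domain :: "('n::finite mat2 \<times> 'n mat2) set" where
  "Sp_retr_domain =
     {(M, M ** symp_J ** S) | M S. M \<in> Sp \<and> S \<in> Sym \<and> det (S + 2 *\<^sub>R symp_J) \<noteq> 0}"

text \<open>
  A tangent vector \<open>V\<close> at \<open>M\<close> is \<open>M ** symp_J ** S\<close> for a unique symmetric \<open>S\<close>; see
  \<open>Sp_retr_eq\<close> below for the resulting formula.
\<close>

definition Sp_retr :: "'n::finite mat2 \<times> 'n mat2 \<Rightarrow> 'n mat2" where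
  "Sp_retr = (\<lambda>(M, V). let S = (THE S. S \<in> Sym \<and> V = M ** symp_J ** S)
     in - (M ** matrix_inv (S + 2 *\<^sub>R symp_J) ** (S - 2 *\<^sub>R symp_J)))"

lemma symp_J_square: "symp_J ** symp_J = (- mat 1 :: 'n::finite mat2)"
proof -
  have sum_split: "(\<Sum>k\<in>UNIV. f k) = (\<Sum>a\<in>UNIV. f (Inl a)) + (\<Sum>a\<in>UNIV. f (Inr a))"
    for f :: "'n + 'n \<Rightarrow> real"
    by (simp add: UNIV_Plus_UNIV[symmetric] sum.Plus del: UNIV_Plus_UNIV)
  have delta: "(\<Sum>a\<in>UNIV. (if i = a then x else 0) * (if a = j then y else 0)) = (if i = j then x * y else 0)"
    for i j :: 'n and x y :: real
  proof -
    have "(\<Sum>a\<in>UNIV. (if i = a then x else 0) * (if a = j then y else 0))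
        = (\<Sum>a\<in>UNIV. if i = a then (if i = j then x * y else 0) else 0)"
      by (intro sum.cong) auto
    then show ?thesis by simp
  qed
  have "(\<Sum>k\<in>UNIV. symp_J $ i $ k * symp_J $ k $ j) = (- mat 1 :: 'n mat2) $ i $ j" for i j :: "'n + 'n"
    unfolding sum_split by (cases i; cases j) (simp_all add: symp_J_def mat_def delta)
  then show ?thesis
    by (simp add: vec_eq_iff matrix_matrix_mult_def)
qed

lemma Sp_tangent_inj:
  fixes M S S' :: "'n::finite mat2"
  assumes "M \<in> Sp" "M ** symp_J ** S = M ** symp_J ** S'"
  shows "S = S'"
proof -
  have M: "transpose M ** symp_J ** M = symp_J"
    using assms(1) by (simp add: Sp_def)
  have *: "transpose M ** symp_J ** (M ** symp_J ** A) = - A" for A :: "'n mat2"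
  proof -
    have "transpose M ** symp_J ** (M ** symp_J ** A)
        = (transpose M ** symp_J ** M) ** symp_J ** A"
      by (simp only: matrix_mul_assoc)
    also have "\<dots> = - (mat 1) ** A"
      by (simp only: M symp_J_square)
    also have "\<dots> = - (mat 1 ** A)"
      by (simp add: vec_eq_iff matrix_matrix_mult_def sum_negf)
    also have "\<dots> = - A"
      by simp
    finally show ?thesis .
  qed
  show ?thesis
    by (metis * assms(2) neg_equal_iff_equal)
qed

lemma Sp_retr_eq:
  assumes "M \<in> Sp" "S \<in> Sym"
  shows "Sp_retr (M, M ** symp_J ** S)
       = - (M ** matrix_inv (S + 2 *\<^sub>R symp_J) ** (S - 2 *\<^sub>R symp_J))"
proof -
  have "(THE S'. S' \<in> Sym \<and> M ** symp_J ** S = M ** symp_J ** S') = S"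
    using assms Sp_tangent_inj by (intro the_equality) auto
  then show ?thesis
    by (simp add: Sp_retr_def)
qed

end

theory Submission
  imports Defs
begin

text \<open>
  On the tangent bundle \<open>S\<close> is the linear expression \<open>- M\<^sup>T J V\<close> in \<open>V = MJS\<close>, so the map extends to
  the rational map \<open>g(M, V) = - M (\<sigma> + 2J)\<^sup>-\<^sup>1 (\<sigma> - 2J)\<close>, \<open>\<sigma> = - M\<^sup>T J V\<close>, on an open set of pairs
  of matrices; smoothness then reduces to that of matrix inversion. With \<open>A = S + 2J\<close> one has
  \<open>S - 2J = A\<^sup>T\<close>, and the Cayley transform \<open>- A\<^sup>-\<^sup>1 A\<^sup>T\<close> is symplectic because
  \<open>A J A\<^sup>T = SJS + 4J = A\<^sup>T J A\<close>. Finally \<open>- A\<^sup>-\<^sup>1 (S - 2J) = - I + 4 A\<^sup>-\<^sup>1 J\<close>, whose derivative at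
  \<open>S = 0\<close> is \<open>- 4 (2J)\<^sup>-\<^sup>1 S (2J)\<^sup>-\<^sup>1 J = JS\<close>.
\<close>

subsection \<open>Calculus of \<open>C\<^sup>k\<close> maps\<close>

text \<open>The recursion for \<open>Ck_on\<close> speaks of \<open>frechet_derivative\<close>; this
  rule accepts any explicit derivative formula on \<open>U\<close> instead, since derivatives are
  unique.\<close>

lemma Ck_on_SucI:
  assumes U: "open U"
    and f: "\<And>x. x \<in> U \<Longrightarrow> (f has_derivative f' x) (at x)"
    and f': "\<And>v. Ck_on k U (\<lambda>x. f' x v)"
  shows "Ck_on (Suc k) U f"
proof -
  \<comment> \<open>\<open>Ck_on\<close> depends only on the values on \<open>U\<close>: as
    \<open>U\<close> is open, functions that agree on \<open>U\<close> have the same derivatives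
    there, and induction carries this to all orders.\<close>
  have cong: "Ck_on k U p \<Longrightarrow> (\<And>x. x \<in> U \<Longrightarrow> q x = p x) \<Longrightarrow> Ck_on k U q"
    for p q :: "'a \<Rightarrow> 'b"
  proof (induction k arbitrary: p q)
    case 0
    then show ?case
      by (simp cong: continuous_on_cong)
  next
    case (Suc k)
    have d: "(q has_derivative frechet_derivative p (at x)) (at x)" if x: "x \<in> U" for x
      using Suc.prems x U
      by (intro has_derivative_transform_within_open[of p _ x UNIV U q])
         (auto simp: frechet_derivative_works[symmetric])
    then have "frechet_derivative q (at x) = frechet_derivative p (at x)" if "x \<in> U" for x
      using frechet_derivative_at that by metis
    with d Suc.prems show ?case
      by (auto simp: differentiable_def intro: Suc.IH)
  qed
  have "frechet_derivative f (at x) = f' x" if "x \<in> U" for x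
    using frechet_derivative_at[OF f[OF that]] by simp
  then have "Ck_on k U (\<lambda>x. frechet_derivative f (at x) v)" for v
    by (intro cong[OF f'[of v]]) simp
  with f show ?thesis
    by (auto simp: differentiable_def)
qed

lemma Ck_on_SucD: "Ck_on (Suc k) U f \<Longrightarrow> Ck_on k U f"
proof (induction k arbitrary: f)
  case 0
  then show ?case
    by (auto intro!: continuous_at_imp_continuous_on differentiable_imp_continuous_within)
next
  case (Suc k)
  then show ?case
    unfolding Ck_on.simps(2)[of "Suc k"] Ck_on.simps(2)[of k U f] by blast
qed

lemma Ck_on_const: "open U \<Longrightarrow> Ck_on k U (\<lambda>x. c)"
proof (induction k arbitrary: c)
  case (Suc k)
  show ?case
    by (rule Ck_on_SucI[where f' = "\<lambda>x v. 0"]) (use Suc in auto)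
qed simp

lemma Ck_on_bounded_linear:
  assumes "open U" "bounded_linear f"
  shows "Ck_on k U f"
proof (cases k)
  case 0
  with assms show ?thesis
    by (simp add: linear_continuous_on)
next
  case (Suc m)
  show ?thesis
    unfolding Suc using assms
    by (intro Ck_on_SucI[where f' = "\<lambda>x. f"] Ck_on_const) (auto intro: bounded_linear_imp_has_derivative)
qed

lemma Ck_on_add:
  assumes "open U" "Ck_on k U f" "Ck_on k U g"
  shows "Ck_on k U (\<lambda>x. f x + g x)"
  using assms(2,3)
proof (induction k arbitrary: f g)
  case 0
  then show ?case
    by (simp add: continuous_on_add)
next
  case (Suc k)
  then show ?case
    by (intro Ck_on_SucI[OF \<open>open U\<close>,
          where f' = "\<lambda>x v. frechet_derivative f (at x) v + frechet_derivative g (at x) v"])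
       (auto intro!: has_derivative_add simp: frechet_derivative_works[symmetric])
qed

text \<open>By the Leibniz rule the derivative is a sum of two values of \<open>h\<close>. In each,
  one argument is a derivative of class \<open>k\<close>, and the other is lowered from class
  \<open>Suc k\<close> to \<open>k\<close>, so the induction hypothesis applies.\<close>

lemma Ck_on_bounded_bilinear:
  assumes "open U" "bounded_bilinear h" "Ck_on k U f" "Ck_on k U g"
  shows "Ck_on k U (\<lambda>x. h (f x) (g x))"
  using assms(3,4)
proof (induction k arbitrary: f g)
  case 0
  then show ?case
    using bounded_bilinear.continuous_on[OF assms(2)] by simp
next
  case (Suc k)
  note SucD = Suc.prems[THEN Ck_on_SucD]
  show ?case
    by (rule Ck_on_SucI[OF \<open>open U\<close>,
          where f' = "\<lambda>x v. h (f x) (frechet_derivative g (at x) v) + h (frechet_derivative f (at x) v) (g x)"])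
       (use Suc SucD in \<open>auto intro!: bounded_bilinear.FDERIV[OF assms(2)] Ck_on_add[OF assms(1)]
          simp: frechet_derivative_works[symmetric]\<close>)
qed

subsection \<open>Matrix inversion\<close>

lemma bounded_bilinear_matrix_mult:
  "bounded_bilinear ((**) :: real^'n^'m \<Rightarrow> real^'p^'n \<Rightarrow> real^'p^'m)"
  unfolding bilinear_conv_bounded_bilinear[symmetric] bilinear_def
  by (auto intro!: linearI simp: matrix_add_ldistrib matrix_scalar_ac scalar_matrix_assoc
      matrix_matrix_mult_def vec_eq_iff sum.distrib distrib_right distrib_left sum_distrib_left mult_ac)

interpretation matrix_mult:
  bounded_bilinear "(**) :: real^'n^'m \<Rightarrow> real^'p^'n \<Rightarrow> real^'p^'m"
  by (rule bounded_bilinear_matrix_mult)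

lemma bounded_linear_transpose: "bounded_linear (transpose :: real^'n^'m \<Rightarrow> real^'m^'n)"
  unfolding linear_conv_bounded_linear[symmetric]
  by (auto intro!: linearI simp: transpose_def vec_eq_iff)

lemma matrix_inv_mult:
  fixes A :: "real^'n^'n"
  assumes "det A \<noteq> 0"
  shows "A ** matrix_inv A = mat 1" "matrix_inv A ** A = mat 1"
proof -
  have "\<exists>B. A ** B = mat 1 \<and> B ** A = mat 1"
    using assms by (simp add: invertible_det_nz[symmetric] invertible_def)
  from someI_ex[OF this] show "A ** matrix_inv A = mat 1" "matrix_inv A ** A = mat 1"
    by (simp_all add: matrix_inv_def)
qed

lemma matrix_inv_unique:
  fixes A :: "real^'n^'n"
  assumes "A ** B = mat 1"
  shows "matrix_inv A = B"
proof -
  have "det A \<noteq> 0"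
    using assms invertible_det_nz invertible_right_inverse by blast
  then have "matrix_inv A ** (A ** B) = B"
    by (simp add: matrix_mul_assoc matrix_inv_mult)
  with assms show ?thesis by simp
qed

lemma continuous_on_det: "continuous_on UNIV (det :: real^'n^'n \<Rightarrow> real)"
  unfolding det_def by (intro continuous_intros)

text \<open>Cramer's rule writes each entry of the inverse as a quotient of two determinants; column
  \<open>l\<close> of the inverse solves \<open>A x = e_l\<close>.\<close>

lemma continuous_on_matrix_inv:
  "continuous_on {A. det A \<noteq> 0} (matrix_inv :: real^'n^'n \<Rightarrow> real^'n^'n)"
proof -
  define c :: "real^'n^'n \<Rightarrow> real^'n^'n" where
    "c A = (\<chi> k l. det (\<chi> i j. if j = k then axis l 1 $ i else A $ i $ j) / det A)" for A
  have "matrix_inv A = c A" if "det A \<noteq> 0" for A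
  proof -
    have "column l (matrix_inv A) = column l (c A)" for l
    proof -
      have "A *v (matrix_inv A *v axis l 1) = axis l 1"
        by (simp add: matrix_vector_mul_assoc matrix_inv_mult that)
      then show ?thesis
        unfolding cramer[OF that]
        by (simp add: matrix_vector_mult_basis) (simp add: c_def column_def)
    qed
    then show ?thesis
      by (simp add: column_def vec_eq_iff)
  qed
  moreover have "continuous_on {A. det A \<noteq> 0} c"
    unfolding c_def
  proof (intro continuous_intros continuous_on_subset[OF continuous_on_det]
      continuous_on_compose2[OF continuous_on_det])
    fix k i j l :: 'n
    show "continuous_on {A::real^'n^'n. det A \<noteq> 0} (\<lambda>A. if j = k then axis l 1 $ i else A $ i $ j)"
      by (cases "j = k") (auto intro!: continuous_intros)
  qed auto
  ultimately show ?thesis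
    by (subst continuous_on_cong[OF refl, of _ _ c]) auto
qed

lemma open_det_nonzero: "open {A :: real^'n^'n. det A \<noteq> 0}"
  using continuous_on_det by (intro open_Collect_neq) auto

text \<open>The identity \<open>B^-1 - A^-1 = - B^-1 (B - A) A^-1\<close> turns the remainder of the
  linear approximation into \<open>- (B^-1 - A^-1) (B - A) A^-1\<close>. Divided by
  \<open>norm (B - A)\<close> it tends to 0, because inversion is already known to be
  continuous.\<close>

lemma has_derivative_matrix_inv:
  fixes A :: "real^'n^'n"
  assumes "det A \<noteq> 0"
  shows "(matrix_inv has_derivative (\<lambda>H. - (matrix_inv A ** H ** matrix_inv A))) (at A)"
proof -
  obtain K where K: "\<And>(X::real^'n^'n) (Y::real^'n^'n). norm (X ** Y) \<le> norm X * norm Y * K" and "K > 0"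
    using matrix_mult.pos_bounded by blast
  obtain e where "e > 0" and e: "\<And>B. dist B A < e \<Longrightarrow> det B \<noteq> 0"
    using assms open_det_nonzero unfolding open_dist by blast
  \<comment> \<open>The factor \<open>K\<close> appears twice, once for each of the two matrix
    products in the remainder.\<close>
  let ?H = "\<lambda>B. norm (matrix_inv B - matrix_inv A) * norm (matrix_inv A) * K * K"
  have "isCont matrix_inv A"
    using continuous_on_matrix_inv assms unfolding continuous_on_eq_continuous_at[OF open_det_nonzero]
    by blast
  then have lim: "(matrix_inv \<longlongrightarrow> matrix_inv A) (at A)"
    by (rule isContD)
  have "((\<lambda>B. norm (matrix_inv B - matrix_inv A)) \<longlongrightarrow> 0) (at A)"
    using tendsto_norm[OF tendsto_diff[OF lim tendsto_const[of "matrix_inv A"]]] by simp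
  then have H: "(?H \<longlongrightarrow> 0) (at A)"
    by (intro tendsto_mult_left_zero)
  show ?thesis
  proof (rule has_derivativeI_sandwich[OF \<open>e > 0\<close> _ _ H])
    show "bounded_linear (\<lambda>H. - (matrix_inv A ** H ** matrix_inv A))"
      by (intro bounded_linear_minus bounded_linear_compose[OF matrix_mult.bounded_linear_left]
          matrix_mult.bounded_linear_right)
  next
    fix B assume "B \<noteq> A" "dist B A < e"
    then have B: "det B \<noteq> 0" using e by blast
    have *: "matrix_inv B - matrix_inv A = - (matrix_inv B ** (B - A) ** matrix_inv A)"
      by (simp add: matrix_mult.diff_left matrix_mult.diff_right matrix_inv_mult[OF B]
          matrix_mul_assoc[symmetric] matrix_inv_mult[OF assms])
    have "matrix_inv B - matrix_inv A - - (matrix_inv A ** (B - A) ** matrix_inv A)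
        = - ((matrix_inv B - matrix_inv A) ** (B - A) ** matrix_inv A)"
      by (subst *) (simp add: matrix_mult.diff_left)
    then have "norm (matrix_inv B - matrix_inv A - - (matrix_inv A ** (B - A) ** matrix_inv A))
        \<le> norm ((matrix_inv B - matrix_inv A) ** (B - A)) * norm (matrix_inv A) * K"
      using K by (simp only: norm_minus_cancel)
    also have "\<dots> \<le> norm (matrix_inv B - matrix_inv A) * norm (B - A) * K * norm (matrix_inv A) * K"
      using K \<open>K > 0\<close> by (intro mult_right_mono) auto
    finally show "norm (matrix_inv B - matrix_inv A - - (matrix_inv A ** (B - A) ** matrix_inv A))
        / norm (B - A) \<le> ?H B"
      using \<open>B \<noteq> A\<close> by (simp add: field_simps)
  qed
qed

text \<open>A bootstrap: the derivative of the inverse is a product of inverses with the derivative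
  of \<open>A\<close>, so class \<open>k\<close> of the inverse yields class
  \<open>Suc k\<close>.\<close>

lemma Ck_on_matrix_inv:
  fixes A :: "'a::euclidean_space \<Rightarrow> real^'n^'n"
  assumes U: "open U" and A: "\<And>k. Ck_on k U A" and det: "\<And>x. x \<in> U \<Longrightarrow> det (A x) \<noteq> 0"
  shows "Ck_on k U (\<lambda>x. matrix_inv (A x))"
proof (induction k)
  case 0
  then show ?case
    using A[of 0] det by (auto intro!: continuous_on_compose2[OF continuous_on_matrix_inv])
next
  case (Suc k)
  let ?A' = "\<lambda>x. frechet_derivative A (at x)"
  have A': "Ck_on k U (\<lambda>x. ?A' x v)" for v
    using A[of "Suc k"] by simp
  have dA: "(A has_derivative ?A' x) (at x)" if "x \<in> U" for x
    using A[of "Suc k"] that by (simp add: frechet_derivative_works[symmetric])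
  show ?case
  proof (rule Ck_on_SucI[OF U])
    show "((\<lambda>x. matrix_inv (A x)) has_derivative
        (\<lambda>v. (- matrix_inv (A x)) ** ?A' x v ** matrix_inv (A x))) (at x)" if "x \<in> U" for x
      using has_derivative_compose[OF dA[OF that] has_derivative_matrix_inv[OF det[OF that]]]
      by (simp add: matrix_mult.minus_left)
    have "Ck_on k U (\<lambda>x. matrix_inv (A x) ** ?A' x v ** matrix_inv (A x))" for v
      using Suc A' by (intro Ck_on_bounded_bilinear[OF U bounded_bilinear_matrix_mult])
    from Ck_on_bounded_bilinear[OF U bounded_bilinear_scaleR Ck_on_const[OF U, of _ "- 1"] this]
    show "Ck_on k U (\<lambda>x. (- matrix_inv (A x)) ** ?A' x v ** matrix_inv (A x))" for v
      by (simp add: matrix_mult.minus_left)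
  qed
qed

subsection \<open>The symplectic group\<close>

lemma transpose_symp_J: "transpose symp_J = - (symp_J :: 'n::finite mat2)"
proof -
  have "transpose symp_J $ i $ j = (- symp_J :: 'n mat2) $ i $ j" for i j
    by (cases i; cases j) (auto simp: transpose_def symp_J_def)
  then show ?thesis
    by (simp only: vec_eq_iff) simp
qed

lemma symp_J_mult_symp_J_mult: "symp_J ** (symp_J ** A) = - (A :: 'n::finite mat2)"
  by (simp add: matrix_mul_assoc symp_J_square matrix_mult.minus_left)

lemma matrix_inv_2_symp_J: "matrix_inv (2 *\<^sub>R symp_J) = (- (1/2) *\<^sub>R symp_J :: 'n::finite mat2)"
  by (rule matrix_inv_unique)
     (simp add: matrix_mult.scaleR_left matrix_mult.scaleR_right matrix_mult.minus_right symp_J_square)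

text \<open>Because \<open>J^2 = -I\<close>, the matrix \<open>2J\<close> has inverse
  \<open>-J/2\<close>. This is the case \<open>S = 0\<close>, which puts the zero section into the
  domain.\<close>

lemma det_2_symp_J: "det (2 *\<^sub>R symp_J :: 'n::finite mat2) \<noteq> 0"
proof -
  have "2 *\<^sub>R symp_J ** (- (1/2) *\<^sub>R symp_J) = (mat 1 :: 'n mat2)"
    by (simp add: matrix_mult.scaleR_left matrix_mult.scaleR_right matrix_mult.minus_right symp_J_square)
  then show ?thesis
    using invertible_det_nz invertible_right_inverse by blast
qed

lemma Sp_mult:
  assumes "M \<in> Sp" "N \<in> Sp"
  shows "M ** N \<in> (Sp :: 'n::finite mat2 set)"
proof -
  have "transpose (M ** N) ** symp_J ** (M ** N) = transpose N ** (transpose M ** symp_J ** M) ** N"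
    by (simp only: matrix_transpose_mul matrix_mul_assoc)
  with assms show ?thesis
    by (simp add: Sp_def)
qed

lemma cayley_in_Sp:
  fixes S :: "'n::finite mat2"
  assumes S: "S \<in> Sym" and det: "det (S + 2 *\<^sub>R symp_J) \<noteq> 0"
  shows "- (matrix_inv (S + 2 *\<^sub>R symp_J) ** (S - 2 *\<^sub>R symp_J)) \<in> Sp"
proof -
  let ?J = "symp_J :: 'n mat2"
  define A where "A = S + 2 *\<^sub>R ?J"
  define B where "B = matrix_inv A"
  have tA: "transpose A = S - 2 *\<^sub>R ?J"
    using S by (simp add: A_def Sym_def linear_add[OF bounded_linear.linear[OF bounded_linear_transpose]]
        transpose_scalar transpose_symp_J)
  have AB: "A ** B = mat 1" and BA: "B ** A = mat 1"
    using det by (simp_all add: A_def B_def matrix_inv_mult)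
  have BA': "transpose B ** transpose A = mat 1" and AB': "transpose A ** transpose B = mat 1"
    using AB BA by (simp_all flip: matrix_transpose_mul)
  \<comment> \<open>In both expansions the mixed terms are \<open>2S\<close> and \<open>-2S\<close>,
    again by \<open>J^2 = -I\<close>, and \<open>-4 J^3 = 4J\<close> remains beside
    \<open>SJS\<close>.\<close>
  have "A ** ?J ** transpose A = transpose A ** ?J ** A"
    unfolding tA unfolding A_def
    by (simp add: matrix_mult.add_left matrix_mult.add_right matrix_mult.diff_left
        matrix_mult.diff_right matrix_mult.scaleR_left matrix_mult.scaleR_right
        symp_J_mult_symp_J_mult symp_J_square matrix_mult.minus_right flip: matrix_mul_assoc)
       (simp add: vec_eq_iff)
  txt \<open>Inverting both sides (\<open>J\<^sup>-\<^sup>1 = - J\<close>) moves the inverses of \<open>A\<close> and \<open>A\<^sup>T\<close> around \<open>J\<close>.\<close>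
  have inv: "matrix_inv (A ** ?J ** transpose A) = - (transpose B ** ?J ** B)"
  proof (rule matrix_inv_unique)
    have "A ** ?J ** transpose A ** - (transpose B ** ?J ** B)
        = - (A ** (?J ** ((transpose A ** transpose B) ** (?J ** B))))"
      by (simp only: matrix_mult.minus_right matrix_mul_assoc)
    then show "A ** ?J ** transpose A ** - (transpose B ** ?J ** B) = mat 1"
      by (simp add: AB' symp_J_mult_symp_J_mult matrix_mult.minus_right AB)
  qed
  have inv': "matrix_inv (transpose A ** ?J ** A) = - (B ** ?J ** transpose B)"
  proof (rule matrix_inv_unique)
    have "transpose A ** ?J ** A ** - (B ** ?J ** transpose B)
        = - (transpose A ** (?J ** ((A ** B) ** (?J ** transpose B))))"
      by (simp only: matrix_mult.minus_right matrix_mul_assoc)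
    then show "transpose A ** ?J ** A ** - (B ** ?J ** transpose B) = mat 1"
      by (simp add: AB symp_J_mult_symp_J_mult matrix_mult.minus_right AB')
  qed
  have BJB: "transpose B ** ?J ** B = B ** ?J ** transpose B"
    using inv inv' \<open>A ** ?J ** transpose A = transpose A ** ?J ** A\<close> by simp
  \<comment> \<open>The transposed product begins with \<open>A\<close> and ends with
    \<open>A^T\<close>; exchanging \<open>B\<close> and \<open>B^T\<close> around \<open>J\<close>
    places each next to the matrix it inverts.\<close>
  have "transpose (B ** transpose A) ** ?J ** (B ** transpose A)
      = A ** (transpose B ** ?J ** B) ** transpose A"
    by (simp add: matrix_transpose_mul matrix_mul_assoc)
  also have "\<dots> = (A ** B) ** ?J ** (transpose B ** transpose A)"
    unfolding BJB by (simp only: matrix_mul_assoc)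
  also have "\<dots> = ?J"
    by (simp add: AB BA')
  finally have "transpose (- (B ** transpose A)) ** ?J ** - (B ** transpose A) = ?J"
    by (simp add: linear_neg[OF bounded_linear.linear[OF bounded_linear_transpose]]
        matrix_mult.minus_left matrix_mult.minus_right)
  then show ?thesis
    by (simp add: Sp_def B_def A_def flip: tA)
qed

text \<open>The inverse of a symplectic \<open>M\<close> is \<open>- J M^T J\<close>: it is a left
  inverse by definition of \<open>Sp\<close>, hence two-sided. No tangency of \<open>V\<close>
  enters, so the identity can be used in every ambient direction.\<close>

lemma Sp_mult_symplectic_inverse:
  fixes M V :: "'n::finite mat2"
  assumes "M \<in> Sp"
  shows "M ** symp_J ** - (transpose M ** symp_J ** V) = V"
proof -
  let ?N = "- (symp_J ** transpose M ** symp_J)"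
  have "?N ** M = - (symp_J ** (transpose M ** symp_J ** M))"
    by (simp only: matrix_mult.minus_left matrix_mul_assoc)
  then have "?N ** M = mat 1"
    using assms by (simp add: Sp_def symp_J_square)
  then have "M ** ?N = mat 1"
    using matrix_left_right_inverse by blast
  moreover have "M ** symp_J ** - (transpose M ** symp_J ** V) = (M ** ?N) ** V"
    by (simp only: matrix_mult.minus_left matrix_mult.minus_right matrix_mul_assoc)
  ultimately show ?thesis by simp
qed

subsection \<open>The ambient extension\<close>

text \<open>An explicit polynomial substitute for the \<open>THE\<close> in \<open>Sp_retr\<close>,
  meaningful for all pairs of matrices and not only for tangent vectors at symplectic ones.\<close>

definition sym_coord :: "'n::finite mat2 \<times> 'n mat2 \<Rightarrow> 'n mat2" where
  "sym_coord p = - (transpose (fst p) ** symp_J ** snd p)"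

definition Sp_retr_ext :: "'n::finite mat2 \<times> 'n mat2 \<Rightarrow> 'n mat2" where
  "Sp_retr_ext p = - (fst p ** matrix_inv (sym_coord p + 2 *\<^sub>R symp_J) ** (sym_coord p - 2 *\<^sub>R symp_J))"

definition ext_domain :: "('n::finite mat2 \<times> 'n mat2) set" where
  "ext_domain = {p. det (sym_coord p + 2 *\<^sub>R symp_J) \<noteq> 0}"

lemma sym_coord_tangent:
  assumes "M \<in> Sp"
  shows "sym_coord (M, M ** symp_J ** S) = S"
proof -
  have "transpose M ** symp_J ** (M ** symp_J ** S)
      = transpose M ** symp_J ** M ** symp_J ** S"
    by (simp only: matrix_mul_assoc)
  with assms show ?thesis
    by (simp add: sym_coord_def Sp_def symp_J_square matrix_mult.minus_left)
qed

lemma Ck_on_sym_coord: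
  assumes "open U"
  shows "Ck_on k U sym_coord"
proof -
  have "Ck_on k U (\<lambda>p. transpose (fst p) ** (- symp_J) ** snd p)"
    by (intro Ck_on_bounded_bilinear[OF assms bounded_bilinear_matrix_mult] Ck_on_const
        Ck_on_bounded_linear assms bounded_linear_compose[OF bounded_linear_transpose]
        bounded_linear_fst bounded_linear_snd)
  then show ?thesis
    by (simp add: sym_coord_def[abs_def] matrix_mult.minus_left matrix_mult.minus_right)
qed

lemma open_ext_domain: "open (ext_domain :: ('n::finite mat2 \<times> 'n mat2) set)"
proof -
  have "continuous_on UNIV (sym_coord :: 'n mat2 \<times> 'n mat2 \<Rightarrow> 'n mat2)"
    using Ck_on_sym_coord[of UNIV 0] by simp
  then show ?thesis
    unfolding ext_domain_def
    by (intro open_Collect_neq continuous_on_compose2[OF continuous_on_det] continuous_intros) auto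
qed

lemma Ck_on_Sp_retr_ext: "Ck_on k ext_domain (Sp_retr_ext :: 'n::finite mat2 \<times> 'n mat2 \<Rightarrow> 'n mat2)"
proof -
  note U = open_ext_domain[where 'n = 'n]
  have sc: "Ck_on k ext_domain (\<lambda>p :: 'n mat2 \<times> 'n mat2. sym_coord p + c)" for k c
    by (intro Ck_on_add Ck_on_sym_coord Ck_on_const U)
  \<comment> \<open>Sign and subtraction are recast as a product with \<open>- mat 1\<close> and the
    addition of a constant, so that the product and sum rules apply.\<close>
  have "Ck_on k ext_domain (\<lambda>p :: 'n mat2 \<times> 'n mat2. fst p ** - mat 1 **
      matrix_inv (sym_coord p + 2 *\<^sub>R symp_J) ** (sym_coord p + - (2 *\<^sub>R symp_J)))"
    by (intro Ck_on_bounded_bilinear[OF U bounded_bilinear_matrix_mult] Ck_on_matrix_inv[OF U] sc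
        Ck_on_const Ck_on_bounded_linear U bounded_linear_fst)
       (simp add: ext_domain_def)
  then show ?thesis
    by (simp add: Sp_retr_ext_def[abs_def] matrix_mult.minus_left matrix_mult.minus_right)
qed

text \<open>The domain is the trace of an open ambient set on the tangent bundle, which makes it
  relatively open there.\<close>

lemma Sp_retr_domain_eq: "Sp_retr_domain = Sigma Sp Sp_tangent \<inter> ext_domain"
  unfolding Sp_retr_domain_def Sp_tangent_def ext_domain_def
  by (auto simp: sym_coord_tangent)

lemma Sp_retr_eq_ext: "p \<in> Sp_retr_domain \<Longrightarrow> Sp_retr p = Sp_retr_ext p"
  unfolding Sp_retr_domain_def Sp_retr_ext_def
  by (auto simp: Sp_retr_eq sym_coord_tangent)

lemma zero_in_Sp_retr_domain: "M \<in> Sp \<Longrightarrow> (M, 0 :: 'n::finite mat2) \<in> Sp_retr_domain"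
  using linear_0[OF bounded_linear.linear[OF bounded_linear_transpose]]
  by (auto simp: Sp_retr_domain_def Sym_def det_2_symp_J intro!: exI[of _ "0 :: 'n mat2"])

lemma Sp_retr_ext_zero: "Sp_retr_ext (M, 0) = (M :: 'n::finite mat2)"
  by (simp add: Sp_retr_ext_def sym_coord_def matrix_inv_2_symp_J matrix_mult.scaleR_left
      matrix_mult.scaleR_right matrix_mult.minus_right matrix_mult.minus_left symp_J_square
      flip: matrix_mul_assoc)

text \<open>For fixed \<open>M\<close> the coordinate is linear, \<open>V\<close> being sent to
  \<open>C V\<close> with \<open>C\<close> the inverse of \<open>MJ\<close>. The derivative is
  therefore the identity on the whole matrix space, in particular on the tangent space.\<close>

lemma Sp_retr_ext_has_derivative:
  fixes M :: "'n::finite mat2"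
  assumes M: "M \<in> Sp"
  shows "((\<lambda>V. Sp_retr_ext (M, V)) has_derivative (\<lambda>V. V)) (at 0)"
proof -
  let ?J = "symp_J :: 'n mat2"
  define C where "C = - (transpose M ** ?J)"
  define A where "A = (\<lambda>V. C ** V + 2 *\<^sub>R ?J)"
  have A0: "A 0 = 2 *\<^sub>R ?J"
    by (simp add: A_def)
  have sc: "sym_coord (M, V) = C ** V" for V
    by (simp add: sym_coord_def C_def matrix_mult.minus_left)
  have dA: "(A has_derivative (\<lambda>H. C ** H)) (at 0)"
    unfolding A_def
    by (auto intro!: derivative_eq_intros
        bounded_linear_imp_has_derivative[OF matrix_mult.bounded_linear_right])
  have dB: "((\<lambda>V. C ** V - 2 *\<^sub>R ?J) has_derivative (\<lambda>H. C ** H)) (at 0)"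
    by (auto intro!: derivative_eq_intros
        bounded_linear_imp_has_derivative[OF matrix_mult.bounded_linear_right])
  have dI: "((\<lambda>V. M ** matrix_inv (A V)) has_derivative
      (\<lambda>H. M ** - (matrix_inv (A 0) ** (C ** H) ** matrix_inv (A 0)))) (at 0)"
    using det_2_symp_J
    by (intro matrix_mult.bounded_linear_right[THEN bounded_linear.has_derivative]
        has_derivative_compose[OF dA has_derivative_matrix_inv]) (simp add: A0)
  have "((\<lambda>V. Sp_retr_ext (M, V)) has_derivative
      (\<lambda>H. - ((M ** matrix_inv (A 0)) ** (C ** H) +
         (M ** - (matrix_inv (A 0) ** (C ** H) ** matrix_inv (A 0))) ** (C ** 0 - 2 *\<^sub>R ?J)))) (at 0)"
    unfolding Sp_retr_ext_def sc
    using has_derivative_minus[OF matrix_mult.FDERIV[OF dI dB]] by (simp add: A_def)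
  moreover have "- ((M ** matrix_inv (A 0)) ** (C ** H) +
      (M ** - (matrix_inv (A 0) ** (C ** H) ** matrix_inv (A 0))) ** (C ** 0 - 2 *\<^sub>R ?J)) = H" for H
  proof -
    \<comment> \<open>With \<open>(2J)^-1 = -J/2\<close>, each of the two terms of the product rule
      contributes half of \<open>M J C H\<close>.\<close>
    have "- ((M ** matrix_inv (A 0)) ** (C ** H) +
        (M ** - (matrix_inv (A 0) ** (C ** H) ** matrix_inv (A 0))) ** (C ** 0 - 2 *\<^sub>R ?J))
        = M ** (?J ** (C ** H))"
      unfolding A0 matrix_inv_2_symp_J
      by (simp add: matrix_mult.scaleR_left matrix_mult.scaleR_right matrix_mult.minus_right
          matrix_mult.minus_left symp_J_square flip: matrix_mul_assoc scaleR_left_distrib)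
    also have "\<dots> = H"
      using Sp_mult_symplectic_inverse[OF M, of H]
      by (simp add: C_def matrix_mult.minus_left matrix_mult.minus_right matrix_mul_assoc)
    finally show ?thesis .
  qed
  ultimately show ?thesis by simp
qed

theorem proposition2p5:
  shows "manifold_retraction (Sp :: 'n::finite mat2 set) Sp_tangent Sp_retr_domain Sp_retr"
  unfolding manifold_retraction_def
proof (intro conjI ballI)
  show "openin (top_of_set (Sigma Sp Sp_tangent)) (Sp_retr_domain :: ('n mat2 \<times> 'n mat2) set)"
    unfolding Sp_retr_domain_eq by (rule openin_open_Int[OF open_ext_domain])
  show "Sp_retr ` Sp_retr_domain \<subseteq> (Sp :: 'n mat2 set)"
  proof (clarsimp simp: Sp_retr_domain_def Sp_retr_eq)
    fix M S :: "'n mat2"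
    assume "M \<in> Sp" "S \<in> Sym" "det (S + 2 *\<^sub>R symp_J) \<noteq> 0"
    \<comment> \<open>The value is \<open>M\<close> times the Cayley transform of \<open>S\<close>,
      a product of two symplectic matrices.\<close>
    from Sp_mult[OF this(1) cayley_in_Sp[OF this(2,3)]]
    show "- (M ** matrix_inv (S + 2 *\<^sub>R symp_J) ** (S - 2 *\<^sub>R symp_J)) \<in> Sp"
      by (simp add: matrix_mult.minus_right matrix_mul_assoc)
  qed
  show "smooth_map_on Sp_retr_domain (Sp_retr :: 'n mat2 \<times> 'n mat2 \<Rightarrow> 'n mat2)"
    unfolding smooth_map_on_def
    \<comment> \<open>A single extension on a single open set serves at every point of the
      domain.\<close>
    by (intro ballI exI[of _ ext_domain] exI[of _ Sp_retr_ext])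
       (use open_ext_domain Ck_on_Sp_retr_ext in \<open>auto simp: Sp_retr_eq_ext Sp_retr_domain_eq\<close>)
next
  fix M :: "'n mat2"
  assume M: "M \<in> Sp"
  show zero: "(M, 0) \<in> Sp_retr_domain"
    using M by (rule zero_in_Sp_retr_domain)
  then show "Sp_retr (M, 0) = M"
    by (simp add: Sp_retr_eq_ext Sp_retr_ext_zero)
  \<comment> \<open>The full ambient derivative restricts to the fibre of the domain, where the map
    and its extension agree.\<close>
  have "((\<lambda>V. Sp_retr (M, V)) has_derivative (\<lambda>V. V)) (at 0 within {V. (M, V) \<in> Sp_retr_domain})"
    by (rule has_derivative_transform[OF _ _ has_derivative_at_withinI[OF Sp_retr_ext_has_derivative[OF M]]])
       (use zero in \<open>auto simp: Sp_retr_eq_ext\<close>)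
  then show "\<exists>L. ((\<lambda>V. Sp_retr (M, V)) has_derivative L) (at 0 within {V. (M, V) \<in> Sp_retr_domain}) \<and>
      (\<forall>V\<in>Sp_tangent M. L V = V)"
    by auto
qed

end
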